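(* Let $(X_k)$ be a Markov chain on a finite state space $E$ with irreducible, aperiodic transition matrix $P$, reversible with respect to its stationary distribution $\pi$, started from $\pi$. Let $\lambda$ be the second largest eigenvalue of $P$, $\lambda_0=\max(0,\lambda)$, and let $f:E\to\mathbb R$ with $\min f(E)=0$, $\max f(E)=1$, $\mu=\mathbb E_\pi f(X_k)$, $S_n=\sum_{k=1}^nf(X_k)$. Let $D=\mathrm{diag}(\sqrt{\pi_i})$, $D_t=\mathrm{diag}(e^{tf(i)/2})$, $\gamma_1=(\sqrt{\pi_i})_{i\in E}$, $G_t=D_tDPD^{-1}D_t$, $H_t=D_t[\lambda_0I+(1-\lambda_0)\gamma_1\gamma_1']D_t$, and let $\zeta(t)$ and $\eta(t)$ be the largest eigenvalues of $G_t$ and $H_t$ respectively. Then for every $\varepsilon>0$, $n\ge1$ and $t\ge0$, $$\mathbb P_\pi[S_n\ge n(\mu+\varepsilon)]\le\|D_t\gamma_1\|^2\zeta(t)^{-1}\exp\{-n[t(\mu+\varepsilon)-\log\zeta(t)]\}\le\|D_t\gamma_1\|^2\eta(t)^{-1}\exp\{-n[t(\mu+\varepsilon)-\log\eta(t)]\},$$ and furthermore $$\mathbb P_\pi[S_n\ge n(\mu+\varepsilon)]\le\exp\{-n[t(\mu+\varepsilon)-\log\eta(t)]\}.$$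
   Context: Reversibility means $\pi_ip_{ij}=\pi_jp_{ji}$ for all $i,j$; then all eigenvalues of $P$ are real, listed as $1=\lambda_1>\lambda_2\ge\cdots$ with multiplicity, and the second largest eigenvalue is $\lambda=\lambda_2$. Diagonal matrices and vectors are indexed by the states of $E$ in a fixed order. $\|\cdot\|$ is the Euclidean norm. Note $DPD^{-1}$ is symmetric, so $G_t$ and $H_t$ are symmetric. *)

theory Defs
  imports "HOL-Analysis.Analysis"
begin

text \<open>Finite state space = finite type 's; a transition matrix is P :: real^'s^'s with
  P $ i $ j = p_ij. Distributions / functions on E are functions 's \<Rightarrow> real.\<close>

primrec mpow :: "real^'s^'s \<Rightarrow> nat \<Rightarrow> real^'s^'s" where
  "mpow P 0 = mat 1"
| "mpow P (Suc n) = mpow P n ** P"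

definition stochastic :: "real^'s::finite^'s \<Rightarrow> bool" where
  "stochastic P \<longleftrightarrow> (\<forall>i j. P $ i $ j \<ge> 0) \<and> (\<forall>i. (\<Sum>j\<in>UNIV. P $ i $ j) = 1)"

definition irreducible_mc :: "real^'s::finite^'s \<Rightarrow> bool" where
  "irreducible_mc P \<longleftrightarrow> (\<forall>i j. \<exists>n. mpow P n $ i $ j > 0)"

definition aperiodic_mc :: "real^'s::finite^'s \<Rightarrow> bool" where
  "aperiodic_mc P \<longleftrightarrow> (\<forall>i. Gcd {n::nat. n > 0 \<and> mpow P n $ i $ i > 0} = 1)"

definition stationary_dist :: "real^'s::finite^'s \<Rightarrow> ('s \<Rightarrow> real) \<Rightarrow> bool" where
  "stationary_dist P \<pi> \<longleftrightarrow> (\<forall>i. \<pi> i \<ge> 0) \<and> (\<Sum>i\<in>UNIV. \<pi> i) = 1 \<and>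
     (\<forall>j. (\<Sum>i\<in>UNIV. \<pi> i * P $ i $ j) = \<pi> j)"

definition reversible_mc :: "real^'s::finite^'s \<Rightarrow> ('s \<Rightarrow> real) \<Rightarrow> bool" where
  "reversible_mc P \<pi> \<longleftrightarrow> (\<forall>i j. \<pi> i * P $ i $ j = \<pi> j * P $ j $ i)"

text \<open>Eigenvalues (real) of a real matrix acting on column vectors.\<close>
definition eigvals :: "real^'s::finite^'s \<Rightarrow> real set" where
  "eigvals A = {l. \<exists>v. v \<noteq> 0 \<and> A *v v = l *\<^sub>R v}"

definition largest_eig :: "real^'s::finite^'s \<Rightarrow> real" where
  "largest_eig A = Max (eigvals A)"

text \<open>Second largest eigenvalue counted with multiplicity, for a diagonalizable matrix
  (P reversible is similar to a symmetric matrix): the largest eigenvalue l such that the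
  eigenvectors with eigenvalues \<ge> l span a space of dimension at least 2.\<close>
definition second_eig :: "real^'s::finite^'s \<Rightarrow> real" where
  "second_eig A = Max {l \<in> eigvals A.
      dim (span {v. \<exists>m \<ge> l. A *v v = m *\<^sub>R v}) \<ge> 2}"

definition diagm :: "('s::finite \<Rightarrow> real) \<Rightarrow> real^'s^'s" where
  "diagm d = (\<chi> i j. if i = j then d i else 0)"

text \<open>Law of the chain (X_0,...,X_n) started from \<pi>: probability of an event on paths,
  paths being lists of length n+1 (xs ! k = X_k).\<close>
definition path_prob :: "real^'s::finite^'s \<Rightarrow> ('s \<Rightarrow> real) \<Rightarrow> nat \<Rightarrow> ('s list \<Rightarrow> bool) \<Rightarrow> real" where
  "path_prob P \<pi> n A = (\<Sum>xs\<in>{xs. length xs = Suc n}.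
     if A xs then \<pi> (xs ! 0) * (\<Prod>k<n. P $ (xs ! k) $ (xs ! Suc k)) else 0)"

end

theory Submission
  imports Defs
begin

text \<open>Chernoff's inequality bounds the probability by exp (- t n (\<mu> + \<epsilon>)) times the
  exponential moment E exp (t S_n), a walk sum of the tilted kernel P_ij exp (t f_j). Conjugation
  by D_t D turns this kernel into the symmetric matrix G_t = D_t (D P D^-1) D_t, so the moment
  equals c' G_t^(n-1) c with c = D_t \<gamma>1. As G_t is symmetric and entrywise nonnegative, its
  operator norm is its largest eigenvalue \<zeta>, and Cauchy-Schwarz gives the first bound.
  Since \<gamma>1 is a unit eigenvector of D P D^-1 for the eigenvalue 1 and every eigenvalue on its
  orthogonal complement is at most \<lambda>, D P D^-1 \<le> \<lambda>0 I + (1 - \<lambda>0) \<gamma>1 \<gamma>1' as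
  quadratic forms; hence G_t \<le> H_t and \<zeta> \<le> \<eta>. Testing H_t at c gives |c|^2 \<le> \<eta>.\<close>

section \<open>Symmetric matrices and the Rayleigh quotient\<close>

lemma symmetric_matrix_inner:
  fixes M :: "real^'n::finite^'n"
  assumes "transpose M = M"
  shows "(M *v x) \<bullet> y = x \<bullet> (M *v y)"
  by (metis assms dot_lmul_matrix transpose_matrix_vector)

lemma quadratic_form_congruence:
  fixes C M :: "real^'n::finite^'n"
  shows "x \<bullet> ((transpose C ** M ** C) *v x) = (C *v x) \<bullet> (M *v (C *v x))"
  by (metis dot_lmul_matrix inner_commute matrix_vector_mul_assoc transpose_matrix_vector)

lemma quadratic_form_sum:
  fixes M :: "real^'n::finite^'n"
  shows "x \<bullet> (M *v x) = (\<Sum>i\<in>UNIV. \<Sum>j\<in>UNIV. x$i * M$i$j * x$j)"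
  by (simp add: inner_vec_def matrix_vector_mult_def sum_distrib_left mult_ac)

lemma norm_power2_vec: "(norm (x :: real^'n::finite))^2 = (\<Sum>i\<in>UNIV. (x$i)^2)"
  by (simp only: power2_norm_eq_inner inner_vec_def) (simp add: power2_eq_square)

lemma quadratic_form_scaleR:
  fixes M :: "real^'n::finite^'n"
  shows "(c *\<^sub>R x) \<bullet> (M *v (c *\<^sub>R x)) = c^2 * (x \<bullet> (M *v x))"
  by (simp add: matrix_vector_mult_scaleR power2_eq_square)

lemma linear_coeff_zero_if_quadratic_nonpos:
  fixes a b :: real
  assumes "\<And>r. 2*r*a + r^2*b \<le> 0"
  shows "a = 0"
proof -
  define k where "k = 1 / (\<bar>b\<bar> + 1)"
  have k: "k > 0" "k * \<bar>b\<bar> < 1" unfolding k_def by (auto simp: field_simps)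
  have "k * (- b) \<le> k * \<bar>b\<bar>" using k(1) by (intro mult_left_mono) auto
  then have "0 < 2 + k*b" using k(2) by (simp add: algebra_simps)
  then have "k * (2 + k*b) > 0" using k(1) by simp
  moreover have "a^2 * (k * (2 + k*b)) \<le> 0"
    using assms[of "a*k"] by (simp add: power2_eq_square algebra_simps)
  ultimately have "a^2 \<le> 0" using mult_le_cancel_right_pos[of _ "a^2" 0] by simp
  then show "a = 0" by simp
qed

text \<open>A first-order perturbation of the maximiser u within S shows that M u - R u is
  orthogonal to S, which contains it.\<close>
lemma symmetric_rayleigh_max:
  fixes M :: "real^'n::finite^'n"
  assumes sym: "transpose M = M" and S: "subspace S" "S \<noteq> {0}"
    and inv: "\<And>x. x \<in> S \<Longrightarrow> M *v x \<in> S"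
  obtains u R where "u \<in> S" "norm u = 1" "M *v u = R *\<^sub>R u"
    "\<And>x. x \<in> S \<Longrightarrow> x \<bullet> (M *v x) \<le> R * (norm x)^2"
proof -
  define q where "q x = x \<bullet> (M *v x)" for x
  define K where "K = S \<inter> sphere 0 1"
  obtain x0 where x0: "x0 \<in> S" "x0 \<noteq> 0" using S subspace_0 by blast
  have "compact K" unfolding K_def using closed_subspace[OF S(1)] by (intro closed_Int_compact) auto
  moreover have "(1 / norm x0) *\<^sub>R x0 \<in> K" unfolding K_def using x0 S(1) by (simp add: subspace_scale)
  moreover have "continuous_on K q" unfolding q_def
    by (intro continuous_intros linear_continuous_on) (simp add: linear_conv_bounded_linear)
  ultimately obtain u where uK: "u \<in> K" and umax: "\<And>y. y \<in> K \<Longrightarrow> q y \<le> q u"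
    using continuous_attains_sup[of K q] by blast
  define R where "R = q u"
  have uS: "u \<in> S" and un: "norm u = 1" using uK by (auto simp: K_def)
  then have uu: "u \<bullet> u = 1" by (simp add: dot_square_norm)
  have bound: "q x \<le> R * (norm x)^2" if "x \<in> S" for x
  proof (cases "x = 0")
    case False
    have "(1 / norm x) *\<^sub>R x \<in> K" unfolding K_def using that False S(1) by (simp add: subspace_scale)
    then have "q ((1 / norm x) *\<^sub>R x) \<le> R" using umax R_def by simp
    moreover have "q ((1 / norm x) *\<^sub>R x) = q x / (norm x)^2"
      unfolding q_def quadratic_form_scaleR by (simp add: power_divide)
    ultimately show ?thesis using False by (simp add: divide_le_eq mult.commute)
  qed (simp add: q_def)
  have perp: "w \<bullet> (M *v u - R *\<^sub>R u) = 0" if w: "w \<in> S" for w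
  proof (rule linear_coeff_zero_if_quadratic_nonpos)
    fix r :: real
    have "u + r *\<^sub>R w \<in> S" using uS w S(1) by (simp add: subspace_add subspace_scale)
    then have "q (u + r *\<^sub>R w) \<le> R * (norm (u + r *\<^sub>R w))^2" by (rule bound)
    moreover have "q (u + r *\<^sub>R w) = R + 2*r*(w \<bullet> (M *v u)) + r^2 * q w"
      using symmetric_matrix_inner[OF sym, of u w]
      by (simp add: q_def R_def matrix_vector_right_distrib matrix_vector_mult_scaleR
          inner_add_left inner_add_right power2_eq_square inner_commute algebra_simps)
    moreover have "(norm (u + r *\<^sub>R w))^2 = 1 + 2*r*(u \<bullet> w) + r^2 * (norm w)^2"
      using uu by (simp only: power2_norm_eq_inner) (simp add: inner_add_left inner_add_right
          power2_eq_square inner_commute algebra_simps)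
    ultimately show "2*r*(w \<bullet> (M *v u - R *\<^sub>R u)) + r^2*(q w - R * (norm w)^2) \<le> 0"
      by (simp add: inner_diff_right inner_commute algebra_simps)
  qed
  have "M *v u - R *\<^sub>R u \<in> S" using uS inv S(1) by (simp add: subspace_diff subspace_scale)
  then have "M *v u = R *\<^sub>R u" using perp[of "M *v u - R *\<^sub>R u"] by simp
  with that uS un bound show ?thesis unfolding q_def by blast
qed

lemma eigvalsI: "v \<noteq> 0 \<Longrightarrow> M *v v = l *\<^sub>R v \<Longrightarrow> l \<in> eigvals M"
  unfolding eigvals_def by auto

lemma eigvalsE:
  assumes "l \<in> eigvals M"
  obtains v where "v \<noteq> 0" "M *v v = l *\<^sub>R v"
  using assms unfolding eigvals_def by auto

lemma symmetric_eigenvectors_orthogonal: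
  fixes M :: "real^'n::finite^'n"
  assumes "transpose M = M" "M *v v = l *\<^sub>R v" "M *v w = m *\<^sub>R w" "l \<noteq> m"
  shows "v \<bullet> w = 0"
proof -
  have "l * (v \<bullet> w) = m * (v \<bullet> w)"
    using symmetric_matrix_inner[OF assms(1), of v w] assms(2,3) by simp
  then show ?thesis using assms(4) by simp
qed

lemma finite_eigvals_symmetric:
  fixes M :: "real^'n::finite^'n"
  assumes sym: "transpose M = M"
  shows "finite (eigvals M)"
proof (rule ccontr)
  assume "infinite (eigvals M)"
  then obtain F where F: "F \<subseteq> eigvals M" "finite F" "card F = Suc CARD('n)"
    using infinite_arbitrarily_large by blast
  define v where "v l = (SOME v. v \<noteq> 0 \<and> M *v v = l *\<^sub>R v)" for l
  have v: "v l \<noteq> 0" "M *v v l = l *\<^sub>R v l" if "l \<in> F" for l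
  proof -
    have "\<exists>v. v \<noteq> 0 \<and> M *v v = l *\<^sub>R v" using that F(1) unfolding eigvals_def by blast
    then have "v l \<noteq> 0 \<and> M *v v l = l *\<^sub>R v l" unfolding v_def by (rule someI_ex)
    then show "v l \<noteq> 0" "M *v v l = l *\<^sub>R v l" by simp_all
  qed
  have inj: "inj_on v F"
  proof (rule inj_onI)
    fix l m assume "l \<in> F" "m \<in> F" "v l = v m"
    have "l *\<^sub>R v l = M *v v l" using v(2)[OF \<open>l \<in> F\<close>] by simp
    also have "\<dots> = m *\<^sub>R v l" using v(2)[OF \<open>m \<in> F\<close>] \<open>v l = v m\<close> by simp
    finally show "l = m" using v(1)[OF \<open>l \<in> F\<close>] by simp
  qed
  have "independent (v ` F)"
  proof (rule pairwise_orthogonal_independent)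
    show "pairwise orthogonal (v ` F)"
      unfolding pairwise_def orthogonal_def
    proof (intro ballI impI)
      fix x y assume "x \<in> v ` F" "y \<in> v ` F" "x \<noteq> y"
      then obtain l m where "l \<in> F" "m \<in> F" "x = v l" "y = v m" "l \<noteq> m" by blast
      then show "x \<bullet> y = 0"
        using symmetric_eigenvectors_orthogonal[OF sym v(2) v(2)] by simp
    qed
    show "0 \<notin> v ` F"
    proof
      assume "0 \<in> v ` F"
      then obtain l where "l \<in> F" "0 = v l" by (rule imageE)
      then show False using v(1) by simp
    qed
  qed
  from independent_bound[OF this] have "card (v ` F) \<le> CARD('n)" by simp
  then show False using F(3) card_image[OF inj] by simp
qed

lemma largest_eig_symmetric:
  fixes M :: "real^'n::finite^'n"
  assumes sym: "transpose M = M"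
  shows "x \<bullet> (M *v x) \<le> largest_eig M * (norm x)^2"
    and "\<exists>u. norm u = 1 \<and> u \<bullet> (M *v u) = largest_eig M"
proof -
  have nontrivial: "(UNIV :: (real^'n) set) \<noteq> {0}"
  proof
    assume "UNIV = {0 :: real^'n}"
    then have "(\<chi> i. 1) = (0 :: real^'n)" by (metis UNIV_I singletonD)
    then show False by (simp add: vec_eq_iff)
  qed
  obtain u R where u: "norm u = 1" "M *v u = R *\<^sub>R u"
    and bound: "\<And>x. x \<in> UNIV \<Longrightarrow> x \<bullet> (M *v x) \<le> R * (norm x)^2"
  proof (rule symmetric_rayleigh_max[OF sym subspace_UNIV nontrivial])
    show "\<And>x. x \<in> UNIV \<Longrightarrow> M *v x \<in> UNIV" by (rule UNIV_I)
  qed (rule that)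
  have "l \<le> R" if l: "l \<in> eigvals M" for l
  proof -
    obtain v where v: "v \<noteq> 0" "M *v v = l *\<^sub>R v" using l by (rule eigvalsE)
    have "l * (v \<bullet> v) = v \<bullet> (M *v v)" using v(2) by simp
    also have "\<dots> \<le> R * (v \<bullet> v)" using bound[of v] by (simp add: power2_norm_eq_inner)
    finally show "l \<le> R" using v(1) by simp
  qed
  moreover have "R \<in> eigvals M" using u by (intro eigvalsI[of u]) auto
  ultimately have R: "largest_eig M = R"
    unfolding largest_eig_def by (rule Max_eqI[OF finite_eigvals_symmetric[OF sym]])
  show "x \<bullet> (M *v x) \<le> largest_eig M * (norm x)^2" unfolding R by (rule bound) simp
  have "u \<bullet> (M *v u) = R * (u \<bullet> u)" using u(2) by simp
  also have "u \<bullet> u = 1" using u(1) by (simp add: dot_square_norm)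
  finally show "\<exists>u. norm u = 1 \<and> u \<bullet> (M *v u) = largest_eig M"
    using u(1) R by (intro exI[of _ u]) simp
qed

lemma largest_eig_mono:
  fixes A B :: "real^'n::finite^'n"
  assumes "transpose A = A" "transpose B = B" "\<And>x. x \<bullet> (A *v x) \<le> x \<bullet> (B *v x)"
  shows "largest_eig A \<le> largest_eig B"
proof -
  obtain u where "norm u = 1" "u \<bullet> (A *v u) = largest_eig A"
    using largest_eig_symmetric(2)[OF assms(1)] by blast
  then show ?thesis using assms(3)[of u] largest_eig_symmetric(1)[OF assms(2), of u] by simp
qed

lemma symmetric_norm_matrix_vector_le:
  fixes M :: "real^'n::finite^'n"
  assumes sym: "transpose M = M" and bound: "\<And>x. \<bar>x \<bullet> (M *v x)\<bar> \<le> z * (norm x)^2"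
  shows "norm (M *v x) \<le> z * norm x"
proof (cases "x = 0")
  case False
  define y where "y = M *v x"
  have "0 \<le> z * (norm x)^2" using abs_ge_zero[of "x \<bullet> (M *v x)"] bound[of x] by linarith
  then have "0 \<le> z" using False by (simp add: zero_le_mult_iff)
  have polar: "4*r*(y \<bullet> y) \<le> 2*z*((norm x)^2 + r^2*(norm y)^2)" for r
  proof -
    have "(x + r *\<^sub>R y) \<bullet> (M *v (x + r *\<^sub>R y)) - (x - r *\<^sub>R y) \<bullet> (M *v (x - r *\<^sub>R y))
        = 4*r*(y \<bullet> y)"
      using symmetric_matrix_inner[OF sym, of x y]
      by (simp add: y_def matrix_vector_right_distrib matrix_vector_mult_diff_distrib
          matrix_vector_mult_scaleR inner_add_left inner_add_right inner_diff_left inner_diff_right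
          inner_commute algebra_simps)
    then have "4*r*(y \<bullet> y) \<le> z * (norm (x + r *\<^sub>R y))^2 + z * (norm (x - r *\<^sub>R y))^2"
      using abs_le_D1[OF bound[of "x + r *\<^sub>R y"]] abs_le_D2[OF bound[of "x - r *\<^sub>R y"]]
      by linarith
    also have "\<dots> = z * ((norm (x + r *\<^sub>R y))^2 + (norm (x - r *\<^sub>R y))^2)"
      by (simp only: distrib_left)
    also have "(norm (x + r *\<^sub>R y))^2 + (norm (x - r *\<^sub>R y))^2 = 2*((norm x)^2 + r^2*(norm y)^2)"
      by (simp only: power2_norm_eq_inner) (simp add: inner_add_left inner_add_right
          inner_diff_left inner_diff_right inner_commute algebra_simps power2_eq_square)
    finally show ?thesis by (simp add: algebra_simps)
  qed
  show ?thesis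
  proof (cases "y = 0")
    case False
    have "4 * norm x * norm y \<le> 4 * z * (norm x)^2"
      using polar[of "norm x / norm y"] False
      by (simp add: power2_norm_eq_inner[symmetric] power_divide field_simps power2_eq_square)
    then show ?thesis using \<open>x \<noteq> 0\<close> by (simp add: y_def power2_eq_square)
  qed (simp add: y_def \<open>0 \<le> z\<close>)
qed simp

text \<open>For a nonnegative matrix |x' M x| \<le> |x|' M |x|.\<close>
lemma norm_matrix_vector_le_largest_eig:
  fixes M :: "real^'n::finite^'n"
  assumes sym: "transpose M = M" and nonneg: "\<And>i j. 0 \<le> M$i$j"
  shows "norm (M *v x) \<le> largest_eig M * norm x"
proof (rule symmetric_norm_matrix_vector_le[OF sym])
  fix x :: "real^'n"
  define xa where "xa = (\<chi> i. \<bar>x$i\<bar>)"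
  have "\<bar>x \<bullet> (M *v x)\<bar> \<le> (\<Sum>i\<in>UNIV. \<Sum>j\<in>UNIV. \<bar>x$i * M$i$j * x$j\<bar>)"
    unfolding quadratic_form_sum by (rule order_trans[OF sum_abs sum_mono[OF sum_abs]])
  also have "\<dots> = xa \<bullet> (M *v xa)"
    unfolding quadratic_form_sum xa_def using nonneg by (simp add: abs_mult)
  also have "\<dots> \<le> largest_eig M * (norm xa)^2" by (rule largest_eig_symmetric(1)[OF sym])
  also have "(norm xa)^2 = (norm x)^2" unfolding norm_power2_vec xa_def by simp
  finally show "\<bar>x \<bullet> (M *v x)\<bar> \<le> largest_eig M * (norm x)^2" .
qed

lemma norm_funpow_matrix_vector_le:
  fixes M :: "real^'n::finite^'n"
  assumes "\<And>x. norm (M *v x) \<le> z * norm x" "0 \<le> z"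
  shows "norm (((*v) M ^^ k) x) \<le> z^k * norm x"
proof (induction k)
  case (Suc k)
  have "norm (((*v) M ^^ Suc k) x) \<le> z * norm (((*v) M ^^ k) x)" using assms(1) by simp
  also have "\<dots> \<le> z * (z^k * norm x)" using Suc assms(2) by (rule mult_left_mono)
  also have "\<dots> = z^Suc k * norm x" by simp
  finally show ?case .
qed simp

text \<open>Split y into its components along g and orthogonal to g; the latter is bounded by the
  Rayleigh maximum on the invariant orthogonal complement of g.\<close>
lemma quadratic_form_le_deflated:
  fixes A :: "real^'n::finite^'n" and g :: "real^'n"
  assumes sym: "transpose A = A" and g: "A *v g = g" "norm g = 1"
    and orth: "\<And>u R. A *v u = R *\<^sub>R u \<Longrightarrow> u \<noteq> 0 \<Longrightarrow> g \<bullet> u = 0 \<Longrightarrow> R \<le> l"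
  shows "y \<bullet> (A *v y) \<le> l * (norm y)^2 + (1 - l) * (g \<bullet> y)^2"
proof -
  have gg: "g \<bullet> g = 1" using g(2) by (simp add: dot_square_norm)
  have complement: "z \<bullet> (A *v z) \<le> l * (norm z)^2" if z: "g \<bullet> z = 0" for z
  proof (cases "z = 0")
    case False
    define S where "S = {x. g \<bullet> x = 0}"
    have "z \<in> S" using z by (simp add: S_def)
    have subspace: "subspace S" unfolding S_def by (simp add: subspace_def inner_add_right)
    have nontrivial: "S \<noteq> {0}" using \<open>z \<in> S\<close> False by (metis singletonD)
    have invariant: "A *v x \<in> S" if "x \<in> S" for x
      using that symmetric_matrix_inner[OF sym, of g x] g(1) by (simp add: S_def)
    obtain u R where u: "u \<in> S" "norm u = 1" "A *v u = R *\<^sub>R u"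
      and bound: "\<And>x. x \<in> S \<Longrightarrow> x \<bullet> (A *v x) \<le> R * (norm x)^2"
    proof (rule symmetric_rayleigh_max[OF sym subspace nontrivial])
      show "\<And>x. x \<in> S \<Longrightarrow> A *v x \<in> S" by (rule invariant)
    qed (rule that)
    have "u \<noteq> 0" "g \<bullet> u = 0" using u(1,2) by (auto simp: S_def)
    then have "R \<le> l" using u(3) by (intro orth)
    then have "R * (norm z)^2 \<le> l * (norm z)^2" by (simp add: mult_right_mono)
    then show ?thesis using bound[OF \<open>z \<in> S\<close>] by linarith
  qed simp
  define a where "a = g \<bullet> y"
  define z where "z = y - a *\<^sub>R g"
  have zg: "g \<bullet> z = 0" unfolding z_def a_def using gg by (simp add: inner_diff_right)
  have gAz: "g \<bullet> (A *v z) = 0" using symmetric_matrix_inner[OF sym, of g z] g(1) zg by simp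
  have y: "y = a *\<^sub>R g + z" unfolding z_def by simp
  have "y \<bullet> (A *v y) = (a *\<^sub>R g + z) \<bullet> (a *\<^sub>R g + A *v z)"
    by (subst (1 2) y) (simp add: matrix_vector_right_distrib matrix_vector_mult_scaleR g(1))
  also have "\<dots> = a^2 + z \<bullet> (A *v z)"
    using gg gAz zg by (simp add: inner_add_left inner_add_right power2_eq_square inner_commute)
  finally have yAy: "y \<bullet> (A *v y) = a^2 + z \<bullet> (A *v z)" .
  have "(norm y)^2 = a^2 + (norm z)^2" unfolding power2_norm_eq_inner
    by (subst (1 2) y) (use gg zg in \<open>simp add: inner_add_left inner_add_right power2_eq_square
        inner_commute\<close>)
  then show ?thesis using yAy complement[OF zg] unfolding a_def[symmetric] by (simp add: algebra_simps)
qed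

lemma second_eig_ge:
  fixes A :: "real^'n::finite^'n"
  assumes "finite (eigvals A)"
    and w: "A *v w = R *\<^sub>R w" "w \<notin> span {v}" and v: "A *v v = m *\<^sub>R v" "v \<noteq> 0" "R \<le> m"
  shows "R \<le> second_eig A"
proof -
  define X where "X = {x. \<exists>m \<ge> R. A *v x = m *\<^sub>R x}"
  have "w \<in> X" using w(1) by (auto simp: X_def)
  moreover have "v \<in> X" unfolding X_def using v(1,3) by (intro CollectI exI[of _ m]) simp
  moreover have "independent {w, v}"
    using w(2) v(2) by (intro independent_insertI independent_empty) simp_all
  moreover have "w \<noteq> v" using w(2) span_base[of v "{v}"] by auto
  ultimately have "2 \<le> dim (span X)"
    using independent_card_le_dim[of "{w, v}" "span X"] span_base[of _ X] by auto
  moreover have "w \<noteq> 0" using w(2) span_zero[of "{v}"] by auto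
  then have "R \<in> eigvals A" using w(1) by (rule eigvalsI)
  ultimately show ?thesis
    unfolding second_eig_def X_def using assms(1) by (intro Max_ge) auto
qed

section \<open>Diagonal scalings and rank-one updates\<close>

lemma diagm_mult_left: "(diagm d ** M) $ i $ j = d i * M $ i $ j"
  by (simp add: diagm_def matrix_matrix_mult_def if_distrib if_distribR cong del: if_weak_cong)

lemma diagm_mult_right: "(M ** diagm d) $ i $ j = M $ i $ j * d j"
  by (simp add: diagm_def matrix_matrix_mult_def if_distrib if_distribR cong del: if_weak_cong)

lemma diagm_vector: "(diagm d *v x) $ i = d i * x $ i"
  by (simp add: diagm_def matrix_vector_mult_def if_distrib if_distribR cong del: if_weak_cong)

lemma diagm_mult_diagm: "diagm d ** diagm d' = diagm (\<lambda>i. d i * d' i)"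
  by (simp add: vec_eq_iff diagm_mult_left) (simp add: diagm_def)

lemma transpose_diagm [simp]: "transpose (diagm d) = diagm d"
  by (simp add: vec_eq_iff transpose_def diagm_def)

lemma transpose_diagm_congruence:
  "transpose M = M \<Longrightarrow> transpose (diagm d ** M ** diagm d) = diagm d ** M ** diagm d"
  by (simp add: matrix_transpose_mul matrix_mul_assoc)

lemma diagm_vector_eq_iff: "(\<And>i. d i \<noteq> 0) \<Longrightarrow> diagm d *v x = diagm d *v y \<longleftrightarrow> x = y"
  by (simp add: vec_eq_iff diagm_vector)

lemma diagm_vector_eq_zero_iff: "(\<And>i. d i \<noteq> 0) \<Longrightarrow> diagm d *v x = 0 \<longleftrightarrow> x = 0"
  by (simp add: vec_eq_iff diagm_vector)

lemma diagm_vector_inverse: "(\<And>i. d i \<noteq> 0) \<Longrightarrow> diagm d *v (diagm (\<lambda>i. 1 / d i) *v x) = x"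
  by (simp add: vec_eq_iff diagm_vector)

lemma matrix_inv_diagm:
  assumes "\<And>i. d i \<noteq> 0"
  shows "matrix_inv (diagm d) = diagm (\<lambda>i. 1 / d i)"
proof -
  let ?B = "diagm (\<lambda>i. 1 / d i)"
  have inverse: "diagm d ** ?B = mat 1" "?B ** diagm d = mat 1"
    using assms by (simp_all add: diagm_mult_diagm) (simp_all add: diagm_def mat_def)
  then have left_inverse: "matrix_inv (diagm d) ** diagm d = mat 1"
    unfolding matrix_inv_def by (rule someI2[of _ ?B, OF conjI]) simp
  have "matrix_inv (diagm d) = matrix_inv (diagm d) ** (diagm d ** ?B)"
    using inverse(1) by (simp add: matrix_mul_rid)
  also have "\<dots> = ?B" using left_inverse by (simp add: matrix_mul_assoc matrix_mul_lid)
  finally show ?thesis .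
qed

lemma rank_one_matrix_vector:
  fixes g :: "real^'n::finite"
  shows "(\<chi> i j. g$i * g$j) *v x = (g \<bullet> x) *\<^sub>R g"
  by (simp add: vec_eq_iff matrix_vector_mult_def inner_vec_def sum_distrib_left mult_ac)

lemma quadratic_form_rank_one_update:
  fixes g :: "real^'n::finite"
  shows "x \<bullet> ((l *\<^sub>R mat 1 + (1 - l) *\<^sub>R (\<chi> i j. g$i * g$j)) *v x)
    = l * (norm x)^2 + (1 - l) * (g \<bullet> x)^2"
proof -
  have "(l *\<^sub>R mat 1 + (1 - l) *\<^sub>R (\<chi> i j. g$i * g$j)) *v x = l *\<^sub>R x + ((1 - l) * (g \<bullet> x)) *\<^sub>R g"
    by (simp add: matrix_vector_mult_add_rdistrib scaleR_matrix_vector_assoc[symmetric]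
        rank_one_matrix_vector)
  then show ?thesis unfolding power2_norm_eq_inner
    by (simp only:) (simp add: inner_add_right inner_commute power2_eq_square)
qed

lemma transpose_rank_one_update:
  fixes g :: "real^'n::finite"
  shows "transpose (l *\<^sub>R mat 1 + (1 - l) *\<^sub>R (\<chi> i j. g$i * g$j))
    = l *\<^sub>R mat 1 + (1 - l) *\<^sub>R (\<chi> i j. g$i * g$j)"
  by (simp add: vec_eq_iff transpose_def mat_def mult.commute)

text \<open>Test the quadratic form at c = D g: with y = D c one has g' y = |c|^2 and, by
  Cauchy-Schwarz, (g' y)^2 \<le> |y|^2, so the form is at least |c|^4.\<close>
lemma norm_diagm_unit_le_largest_eig:
  fixes g :: "real^'n::finite"
  assumes g: "norm g = 1" and e: "\<And>i. e i \<noteq> 0" and "0 \<le> l"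
  shows "(norm (diagm e *v g))^2
    \<le> largest_eig (diagm e ** (l *\<^sub>R mat 1 + (1 - l) *\<^sub>R (\<chi> i j. g$i * g$j)) ** diagm e)"
proof -
  define B where "B = l *\<^sub>R mat 1 + (1 - l) *\<^sub>R (\<chi> i j. g$i * g$j)"
  define c where "c = diagm e *v g"
  define y where "y = diagm e *v c"
  have gg: "g \<bullet> g = 1" using g by (simp add: dot_square_norm)
  have "g \<noteq> 0" using g by auto
  then have "c \<noteq> 0" unfolding c_def using diagm_vector_eq_zero_iff[of e, OF e] by simp
  have gy: "g \<bullet> y = (norm c)^2"
    unfolding y_def c_def power2_norm_eq_inner by (simp add: symmetric_matrix_inner)
  have "l * (g \<bullet> y)^2 \<le> l * (norm y)^2"
    using Cauchy_Schwarz_ineq[of g y] gg \<open>0 \<le> l\<close>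
    by (intro mult_left_mono) (simp_all add: power2_norm_eq_inner)
  then have "(norm c)^2 * (norm c)^2 \<le> l * (norm y)^2 + (1 - l) * (g \<bullet> y)^2"
    unfolding gy left_diff_distrib by (simp add: power2_eq_square)
  also have "\<dots> = c \<bullet> ((diagm e ** B ** diagm e) *v c)"
    using quadratic_form_congruence[of c "diagm e" B]
    by (simp add: y_def B_def quadratic_form_rank_one_update)
  also have "\<dots> \<le> largest_eig (diagm e ** B ** diagm e) * (norm c)^2"
    by (rule largest_eig_symmetric(1))
      (simp add: B_def transpose_diagm_congruence transpose_rank_one_update)
  finally have "(norm c)^2 * (norm c)^2 \<le> largest_eig (diagm e ** B ** diagm e) * (norm c)^2" .
  moreover have "0 < (norm c)^2" using \<open>c \<noteq> 0\<close> by simp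
  ultimately show ?thesis unfolding c_def B_def by (rule mult_right_le_imp_le)
qed

section \<open>Markov chains and Chernoff's bound\<close>

lemma mpow_nonneg: "stochastic P \<Longrightarrow> 0 \<le> mpow P n $ i $ j"
  by (induction n arbitrary: i j)
    (simp_all add: mat_def stochastic_def matrix_matrix_mult_def sum_nonneg)

lemma stationary_dist_mpow:
  assumes "stationary_dist P \<pi>"
  shows "(\<Sum>i\<in>UNIV. \<pi> i * mpow P n $ i $ j) = \<pi> j"
proof (induction n arbitrary: j)
  case 0
  show ?case by (simp add: mat_def if_distrib cong: if_cong)
next
  case (Suc n)
  have "(\<Sum>i\<in>UNIV. \<pi> i * mpow P (Suc n) $ i $ j)
      = (\<Sum>i\<in>UNIV. \<Sum>k\<in>UNIV. \<pi> i * mpow P n $ i $ k * P $ k $ j)"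
    by (simp add: matrix_matrix_mult_def sum_distrib_left mult.assoc)
  also have "\<dots> = (\<Sum>k\<in>UNIV. (\<Sum>i\<in>UNIV. \<pi> i * mpow P n $ i $ k) * P $ k $ j)"
    by (subst sum.swap) (simp add: sum_distrib_right)
  also have "\<dots> = \<pi> j" using Suc assms by (simp add: stationary_dist_def)
  finally show ?case .
qed

lemma stationary_dist_pos:
  assumes "stochastic P" and "irreducible_mc P" and sd: "stationary_dist P \<pi>"
  shows "0 < \<pi> j"
proof -
  have nonneg: "\<And>i. 0 \<le> \<pi> i" and "(\<Sum>i\<in>UNIV. \<pi> i) = 1"
    using sd by (auto simp: stationary_dist_def)
  then obtain i where "0 < \<pi> i" by (metis less_eq_real_def sum.neutral zero_neq_one)
  moreover obtain n where "0 < mpow P n $ i $ j" using assms(2) by (auto simp: irreducible_mc_def)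
  moreover have "\<pi> i * mpow P n $ i $ j \<le> (\<Sum>k\<in>UNIV. \<pi> k * mpow P n $ k $ j)"
    by (rule member_le_sum) (simp_all add: nonneg mpow_nonneg[OF assms(1)])
  ultimately show ?thesis
    unfolding stationary_dist_mpow[OF sd] by (meson mult_pos_pos order_less_le_trans)
qed

text \<open>Compare the eigen-equation with the row sum of P at a coordinate where |w| is largest.\<close>
lemma stochastic_eigenvalue_le_1:
  assumes "stochastic P" and eig: "P *v w = R *\<^sub>R w" and "w \<noteq> 0"
  shows "R \<le> 1"
proof -
  have "Max (range (\<lambda>j. \<bar>w$j\<bar>)) \<in> range (\<lambda>j. \<bar>w$j\<bar>)" by (rule Max_in) auto
  then obtain i where i: "Max (range (\<lambda>j. \<bar>w$j\<bar>)) = \<bar>w$i\<bar>" by (rule rangeE)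
  have max: "\<bar>w$j\<bar> \<le> \<bar>w$i\<bar>" for j unfolding i[symmetric] by (rule Max_ge) auto
  obtain j where "w$j \<noteq> 0" using \<open>w \<noteq> 0\<close> by (auto simp: vec_eq_iff)
  then have "0 < \<bar>w$i\<bar>" using max[of j] by linarith
  have "\<bar>R\<bar> * \<bar>w$i\<bar> = \<bar>\<Sum>j\<in>UNIV. P$i$j * w$j\<bar>"
    using arg_cong[OF eig, of "\<lambda>v. \<bar>v$i\<bar>"] by (simp add: matrix_vector_mult_def abs_mult)
  also have "\<dots> \<le> (\<Sum>j\<in>UNIV. P$i$j * \<bar>w$i\<bar>)"
    using assms(1) max unfolding stochastic_def
    by (intro order_trans[OF sum_abs] sum_mono) (simp add: abs_mult mult_left_mono)
  also have "\<dots> = \<bar>w$i\<bar>" using assms(1) by (simp add: stochastic_def sum_distrib_right[symmetric])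
  finally show ?thesis using \<open>0 < \<bar>w$i\<bar>\<close> by (simp add: mult_le_cancel_right2)
qed

text \<open>walk_sum Q n i is the total weight of the walks of length n starting at i, a walk
  i = x_0, x_1, ..., x_n having weight Q x_0 x_1 * ... * Q x_(n-1) x_n.\<close>
primrec walk_sum :: "('s \<Rightarrow> 's \<Rightarrow> real) \<Rightarrow> nat \<Rightarrow> 's \<Rightarrow> real" where
  "walk_sum Q 0 i = 1"
| "walk_sum Q (Suc n) i = (\<Sum>j\<in>UNIV. Q i j * walk_sum Q n j)"

lemma sum_paths_eq_walk_sum:
  fixes Q :: "'s::finite \<Rightarrow> 's \<Rightarrow> real"
  shows "(\<Sum>xs | length xs = Suc n. h (xs!0) * (\<Prod>k<n. Q (xs!k) (xs!Suc k)))
       = (\<Sum>i\<in>UNIV. h i * walk_sum Q n i)"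
proof (induction n arbitrary: h)
  case 0
  have "{xs :: 's list. length xs = Suc 0} = (\<lambda>x. [x]) ` UNIV"
    by (auto simp: length_Suc_conv)
  then show ?case by (simp add: sum.reindex inj_def)
next
  case (Suc n)
  have paths: "{xs :: 's list. length xs = Suc (Suc n)}
      = (\<lambda>(x, ys). x # ys) ` (UNIV \<times> {ys. length ys = Suc n})"
    by (auto simp: length_Suc_conv image_iff)
  have inj: "inj_on (\<lambda>(x :: 's, ys). x # ys) (UNIV \<times> {ys. length ys = Suc n})"
    by (auto simp: inj_on_def)
  have "(\<Sum>xs | length xs = Suc (Suc n). h (xs!0) * (\<Prod>k<Suc n. Q (xs!k) (xs!Suc k)))
     = (\<Sum>(x, ys) \<in> UNIV \<times> {ys. length ys = Suc n}.
          h x * (Q x (ys!0) * (\<Prod>k<n. Q (ys!k) (ys!Suc k))))"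
    unfolding paths sum.reindex[OF inj]
    by (rule sum.cong) (auto simp: prod.lessThan_Suc_shift simp del: prod.lessThan_Suc)
  also have "\<dots> = (\<Sum>x\<in>UNIV. h x * (\<Sum>ys | length ys = Suc n.
          Q x (ys!0) * (\<Prod>k<n. Q (ys!k) (ys!Suc k))))"
    by (simp add: sum.cartesian_product[symmetric] sum_distrib_left)
  also have "\<dots> = (\<Sum>x\<in>UNIV. h x * walk_sum Q (Suc n) x)"
    using Suc[of "Q _"] by simp
  finally show ?case .
qed

text \<open>Chernoff's bound: on every path, the indicator of the event is at most
  exp (t * (S - a)), and the expectation of exp (t * S) factorises along the path.\<close>
lemma path_prob_le_exp_moment:
  fixes P :: "real^'s::finite^'s"
  assumes "stochastic P" and nonneg: "\<And>i. 0 \<le> \<pi> i" and "0 \<le> t"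
  shows "path_prob P \<pi> n (\<lambda>xs. a \<le> (\<Sum>k=1..n. f (xs!k)))
    \<le> exp (- (t * a)) * (\<Sum>i\<in>UNIV. \<pi> i * walk_sum (\<lambda>i j. P$i$j * exp (t * f j)) n i)"
proof -
  define w where "w xs = \<pi> (xs!0) * (\<Prod>k<n. P $ (xs!k) $ (xs!Suc k))" for xs :: "'s list"
  define S where "S xs = (\<Sum>k=1..n. f (xs!k))" for xs :: "'s list"
  have w_nonneg: "0 \<le> w xs" for xs
    using assms(1) nonneg unfolding w_def stochastic_def by (intro mult_nonneg_nonneg prod_nonneg) auto
  have markov: "(if a \<le> S xs then w xs else 0) \<le> w xs * exp (t * (S xs - a))" for xs
  proof (cases "a \<le> S xs")
    case True
    then have "0 \<le> t * (S xs - a)" using \<open>0 \<le> t\<close> by simp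
    then show ?thesis using True w_nonneg[of xs] by (simp add: mult_le_cancel_left1)
  qed (simp add: w_nonneg)
  have exp_S: "w xs * exp (t * (S xs - a))
      = exp (- (t * a)) * (\<pi> (xs!0) * (\<Prod>k<n. P $ (xs!k) $ (xs!Suc k) * exp (t * f (xs!Suc k))))"
    for xs
  proof -
    have "exp (t * S xs) = (\<Prod>k<n. exp (t * f (xs!Suc k)))"
      by (simp add: S_def sum.atLeast1_atMost_eq sum_distrib_left exp_sum)
    then show ?thesis
      by (simp add: w_def prod.distrib right_diff_distrib exp_diff exp_minus field_simps)
  qed
  have "path_prob P \<pi> n (\<lambda>xs. a \<le> S xs) = (\<Sum>xs | length xs = Suc n. if a \<le> S xs then w xs else 0)"
    unfolding path_prob_def w_def by simp
  also have "\<dots> \<le> (\<Sum>xs | length xs = Suc n. w xs * exp (t * (S xs - a)))"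
    by (rule sum_mono) (rule markov)
  also have "\<dots> = exp (- (t * a)) * (\<Sum>i\<in>UNIV. \<pi> i * walk_sum (\<lambda>i j. P$i$j * exp (t * f j)) n i)"
    unfolding exp_S sum_distrib_left[symmetric]
    using sum_paths_eq_walk_sum[of \<pi> "\<lambda>i j. P$i$j * exp (t * f j)" n] by simp
  finally show ?thesis unfolding S_def .
qed

section \<open>The symmetrised reversible chain\<close>

locale reversible_chain =
  fixes P :: "real^'s::finite^'s" and \<pi> :: "'s \<Rightarrow> real"
  assumes stochastic: "stochastic P"
    and pi_pos: "\<And>i. 0 < \<pi> i"
    and pi_sum: "(\<Sum>i\<in>UNIV. \<pi> i) = 1"
    and reversible: "reversible_mc P \<pi>"
begin

text \<open>root_pi and sym_P are the vector \<gamma>1 and the matrix D P D^-1 of the statement.\<close>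
definition root_pi :: "real^'s" where
  "root_pi = (\<chi> i. sqrt (\<pi> i))"

definition sym_P :: "real^'s^'s" where
  "sym_P = (\<chi> i j. sqrt (\<pi> i) * P$i$j / sqrt (\<pi> j))"

lemma sqrt_pi_nonzero: "sqrt (\<pi> i) \<noteq> 0"
  using pi_pos[of i] by simp

lemma pi_mult_P_sum: "(\<Sum>i\<in>UNIV. \<pi> i * P$i$j) = \<pi> j"
proof -
  have "(\<Sum>i\<in>UNIV. \<pi> i * P$i$j) = \<pi> j * (\<Sum>i\<in>UNIV. P$j$i)"
    using reversible by (simp add: reversible_mc_def sum_distrib_left)
  then show ?thesis using stochastic by (simp add: stochastic_def)
qed

lemma sym_P_eq_conj:
  "diagm (\<lambda>i. sqrt (\<pi> i)) ** P ** matrix_inv (diagm (\<lambda>i. sqrt (\<pi> i))) = sym_P"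
  by (simp add: matrix_inv_diagm[of "\<lambda>i. sqrt (\<pi> i)", OF sqrt_pi_nonzero] vec_eq_iff
      diagm_mult_left diagm_mult_right sym_P_def)

lemma transpose_sym_P: "transpose sym_P = sym_P"
proof -
  have "sqrt (\<pi> i) * P$i$j / sqrt (\<pi> j) = sqrt (\<pi> j) * P$j$i / sqrt (\<pi> i)" for i j
  proof -
    have pi: "sqrt (\<pi> k) * sqrt (\<pi> k) = \<pi> k" for k using pi_pos[of k] by simp
    have "sqrt (\<pi> i) * (sqrt (\<pi> i) * P$i$j) = sqrt (\<pi> j) * (sqrt (\<pi> j) * P$j$i)"
      unfolding mult.assoc[symmetric] pi using reversible by (simp add: reversible_mc_def)
    then show ?thesis using sqrt_pi_nonzero[of i] sqrt_pi_nonzero[of j] by (simp add: field_simps)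
  qed
  then show ?thesis by (simp add: vec_eq_iff transpose_def sym_P_def)
qed

lemma sym_P_mult_diagm_vector:
  "sym_P *v (diagm (\<lambda>i. sqrt (\<pi> i)) *v w) = diagm (\<lambda>i. sqrt (\<pi> i)) *v (P *v w)"
proof (unfold vec_eq_iff, intro allI)
  fix i
  have "sym_P$i$j * (sqrt (\<pi> j) * w$j) = sqrt (\<pi> i) * (P$i$j * w$j)" for j
    using sqrt_pi_nonzero[of j] by (simp add: sym_P_def)
  then have "(\<Sum>j\<in>UNIV. sym_P$i$j * (sqrt (\<pi> j) * w$j)) = (\<Sum>j\<in>UNIV. sqrt (\<pi> i) * (P$i$j * w$j))"
    by (rule sum.cong[OF refl])
  then show "(sym_P *v (diagm (\<lambda>i. sqrt (\<pi> i)) *v w)) $ i = (diagm (\<lambda>i. sqrt (\<pi> i)) *v (P *v w)) $ i"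
    by (simp add: matrix_vector_mult_def[of sym_P] matrix_vector_mult_def[of P] diagm_vector
        sum_distrib_left)
qed

lemma sym_P_eigen_iff:
  "sym_P *v (diagm (\<lambda>i. sqrt (\<pi> i)) *v w) = R *\<^sub>R (diagm (\<lambda>i. sqrt (\<pi> i)) *v w)
    \<longleftrightarrow> P *v w = R *\<^sub>R w"
  unfolding sym_P_mult_diagm_vector matrix_vector_mult_scaleR[symmetric]
  using diagm_vector_eq_iff[of "\<lambda>i. sqrt (\<pi> i)", OF sqrt_pi_nonzero] .

lemma finite_eigvals_P: "finite (eigvals P)"
proof (rule finite_subset)
  show "eigvals P \<subseteq> eigvals sym_P"
  proof
    fix l assume "l \<in> eigvals P"
    then obtain w where "w \<noteq> 0" "P *v w = l *\<^sub>R w" by (rule eigvalsE)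
    then show "l \<in> eigvals sym_P"
      by (intro eigvalsI[of "diagm (\<lambda>i. sqrt (\<pi> i)) *v w"])
        (simp_all add: sym_P_eigen_iff diagm_vector_eq_zero_iff[of _ w, OF sqrt_pi_nonzero])
  qed
qed (rule finite_eigvals_symmetric[OF transpose_sym_P])

lemma P_mult_ones: "P *v (\<chi> i. 1) = (\<chi> i. 1)"
  using stochastic by (simp add: vec_eq_iff matrix_vector_mult_def stochastic_def)

lemma root_pi_eq_diagm_ones: "root_pi = diagm (\<lambda>i. sqrt (\<pi> i)) *v (\<chi> i. 1)"
  by (simp add: vec_eq_iff diagm_vector root_pi_def)

lemma sym_P_root_pi: "sym_P *v root_pi = root_pi"
  using sym_P_eigen_iff[of "\<chi> i. 1" 1] P_mult_ones by (simp add: root_pi_eq_diagm_ones)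

lemma norm_root_pi: "norm root_pi = 1"
  using pi_pos pi_sum by (simp add: norm_eq_sqrt_inner inner_vec_def root_pi_def less_imp_le)

text \<open>An eigenvector u of sym_P orthogonal to root_pi corresponds to the eigenvector
  D^-1 u of P, which is not constant; with the constant eigenvector (eigenvalue 1 \<ge> R)
  it spans a two-dimensional space of eigenvectors with eigenvalues \<ge> R.\<close>
lemma eigenvalue_orthogonal_root_pi_le_second_eig:
  assumes eig: "sym_P *v u = R *\<^sub>R u" and "u \<noteq> 0" and orth: "root_pi \<bullet> u = 0"
  shows "R \<le> second_eig P"
proof -
  define w where "w = diagm (\<lambda>i. 1 / sqrt (\<pi> i)) *v u"
  have u: "u = diagm (\<lambda>i. sqrt (\<pi> i)) *v w"
    unfolding w_def by (rule diagm_vector_inverse[symmetric, OF sqrt_pi_nonzero])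
  have Pw: "P *v w = R *\<^sub>R w" using eig unfolding u sym_P_eigen_iff .
  have "w \<noteq> 0" using \<open>u \<noteq> 0\<close> unfolding u by auto
  have "w \<notin> span {\<chi> i. 1}"
  proof
    assume "w \<in> span {\<chi> i. 1}"
    then obtain k where "w = k *\<^sub>R (\<chi> i. 1)" by (auto simp: span_singleton)
    then have "u = k *\<^sub>R root_pi" unfolding u root_pi_eq_diagm_ones by (simp add: matrix_vector_mult_scaleR)
    then have "k = 0" using orth norm_root_pi by (simp add: dot_square_norm)
    then show False using \<open>u = k *\<^sub>R root_pi\<close> \<open>u \<noteq> 0\<close> by simp
  qed
  moreover have "R \<le> 1" by (rule stochastic_eigenvalue_le_1[OF stochastic Pw \<open>w \<noteq> 0\<close>])
  moreover have "(\<chi> i. 1) \<noteq> (0 :: real^'s)" by (simp add: vec_eq_iff)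
  ultimately show ?thesis
    using P_mult_ones by (intro second_eig_ge[OF finite_eigvals_P Pw, of "\<chi> i. 1" 1]) simp_all
qed

lemma quadratic_form_sym_P_le:
  "y \<bullet> (sym_P *v y)
    \<le> max 0 (second_eig P) * (norm y)^2 + (1 - max 0 (second_eig P)) * (root_pi \<bullet> y)^2"
proof (rule quadratic_form_le_deflated[OF transpose_sym_P sym_P_root_pi norm_root_pi])
  fix u R assume "sym_P *v u = R *\<^sub>R u" "u \<noteq> 0" "root_pi \<bullet> u = 0"
  then have "R \<le> second_eig P" by (rule eigenvalue_orthogonal_root_pi_le_second_eig)
  then show "R \<le> max 0 (second_eig P)" by simp
qed

lemma tilted_sym_P_nonneg:
  assumes "\<And>i. 0 \<le> e i"
  shows "0 \<le> (diagm e ** sym_P ** diagm e) $ i $ j"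
proof -
  have "0 \<le> P$i$j" using stochastic by (simp add: stochastic_def)
  then have "0 \<le> e i * (sqrt (\<pi> i) * P$i$j / sqrt (\<pi> j)) * e j"
    using assms[of i] assms[of j] less_imp_le[OF pi_pos]
    by (intro mult_nonneg_nonneg divide_nonneg_nonneg) simp_all
  then show ?thesis by (simp add: diagm_mult_left diagm_mult_right sym_P_def)
qed

lemma largest_eig_tilted_sym_P_pos:
  assumes e: "\<And>i. e i \<noteq> 0"
  shows "0 < largest_eig (diagm e ** sym_P ** diagm e)"
proof (rule ccontr)
  assume "\<not> 0 < largest_eig (diagm e ** sym_P ** diagm e)"
  then have nonpos: "largest_eig (diagm e ** sym_P ** diagm e) * (norm x)^2 \<le> 0" for x
    by (simp add: mult_nonpos_nonneg)
  define x where "x = diagm (\<lambda>i. 1 / e i) *v root_pi"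
  have "diagm e *v x = root_pi" unfolding x_def by (rule diagm_vector_inverse[of e, OF e])
  then have "x \<bullet> ((diagm e ** sym_P ** diagm e) *v x) = 1"
    using quadratic_form_congruence[of x "diagm e" sym_P] sym_P_root_pi norm_root_pi
    by (simp add: dot_square_norm)
  moreover have "x \<bullet> ((diagm e ** sym_P ** diagm e) *v x)
      \<le> largest_eig (diagm e ** sym_P ** diagm e) * (norm x)^2"
    by (rule largest_eig_symmetric(1)[OF transpose_diagm_congruence[OF transpose_sym_P]])
  ultimately show False using nonpos[of x] by linarith
qed

lemma largest_eig_tilted_sym_P_le:
  "largest_eig (diagm e ** sym_P ** diagm e)
    \<le> largest_eig (diagm e ** (max 0 (second_eig P) *\<^sub>R mat 1
        + (1 - max 0 (second_eig P)) *\<^sub>R (\<chi> i j. root_pi$i * root_pi$j)) ** diagm e)"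
proof (rule largest_eig_mono)
  show "transpose (diagm e ** sym_P ** diagm e) = diagm e ** sym_P ** diagm e"
    by (rule transpose_diagm_congruence[OF transpose_sym_P])
  show "transpose (diagm e ** (max 0 (second_eig P) *\<^sub>R mat 1
        + (1 - max 0 (second_eig P)) *\<^sub>R (\<chi> i j. root_pi$i * root_pi$j)) ** diagm e)
      = diagm e ** (max 0 (second_eig P) *\<^sub>R mat 1
        + (1 - max 0 (second_eig P)) *\<^sub>R (\<chi> i j. root_pi$i * root_pi$j)) ** diagm e"
    by (rule transpose_diagm_congruence[OF transpose_rank_one_update])
  fix x
  show "x \<bullet> ((diagm e ** sym_P ** diagm e) *v x)
    \<le> x \<bullet> ((diagm e ** (max 0 (second_eig P) *\<^sub>R mat 1
        + (1 - max 0 (second_eig P)) *\<^sub>R (\<chi> i j. root_pi$i * root_pi$j)) ** diagm e) *v x)"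
    using quadratic_form_sym_P_le[of "diagm e *v x"]
    by (simp add: quadratic_form_congruence[of x "diagm e", simplified]
        quadratic_form_rank_one_update)
qed

text \<open>Conjugating by diag (e * sqrt \<pi>) turns the tilted kernel P_ij e_j^2 into
  diag e * sym_P * diag e, so its iterates applied to the constant vector become the iterates
  of the symmetric matrix applied to diag e * root_pi.\<close>
lemma exp_moment_eq_iterate:
  "(\<Sum>i\<in>UNIV. \<pi> i * walk_sum (\<lambda>i j. P$i$j * (e j)^2) (Suc k) i)
    = (diagm e *v root_pi) \<bullet> (((*v) (diagm e ** sym_P ** diagm e)) ^^ k) (diagm e *v root_pi)"
proof -
  define Q where "Q i j = P$i$j * (e j)^2" for i j
  define G where "G = diagm e ** sym_P ** diagm e"
  have iterate: "((*v) G ^^ m) (diagm e *v root_pi) = (\<chi> i. e i * sqrt (\<pi> i) * walk_sum Q m i)"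
    for m
  proof (induction m)
    case 0
    show ?case by (simp add: vec_eq_iff diagm_vector root_pi_def)
  next
    case (Suc m)
    have "(G *v (\<chi> j. e j * sqrt (\<pi> j) * walk_sum Q m j)) $ i
        = e i * sqrt (\<pi> i) * walk_sum Q (Suc m) i" for i
    proof -
      have "G$i$j * (e j * sqrt (\<pi> j) * walk_sum Q m j)
          = e i * sqrt (\<pi> i) * (Q i j * walk_sum Q m j)" for j
        using sqrt_pi_nonzero[of j]
        by (simp add: G_def Q_def diagm_mult_left diagm_mult_right sym_P_def power2_eq_square)
      then have "(\<Sum>j\<in>UNIV. G$i$j * (e j * sqrt (\<pi> j) * walk_sum Q m j))
          = (\<Sum>j\<in>UNIV. e i * sqrt (\<pi> i) * (Q i j * walk_sum Q m j))"
        by (rule sum.cong[OF refl])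
      then show ?thesis by (simp add: matrix_vector_mult_def[of G] sum_distrib_left)
    qed
    then show ?case by (simp add: Suc.IH vec_eq_iff)
  qed
  have square: "(e j * sqrt (\<pi> j)) * (e j * sqrt (\<pi> j) * w) = \<pi> j * ((e j)^2 * w)" for j w
  proof -
    have "(e j * sqrt (\<pi> j)) * (e j * sqrt (\<pi> j) * w) = (sqrt (\<pi> j) * sqrt (\<pi> j)) * ((e j)^2 * w)"
      by (simp only: power2_eq_square mult_ac)
    then show ?thesis using pi_pos[of j] by simp
  qed
  have "(\<Sum>i\<in>UNIV. \<pi> i * walk_sum Q (Suc k) i)
      = (\<Sum>i\<in>UNIV. \<Sum>j\<in>UNIV. \<pi> i * P$i$j * ((e j)^2 * walk_sum Q k j))"
    by (simp add: Q_def sum_distrib_left mult_ac)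
  also have "\<dots> = (\<Sum>j\<in>UNIV. \<Sum>i\<in>UNIV. \<pi> i * P$i$j * ((e j)^2 * walk_sum Q k j))"
    by (rule sum.swap)
  also have "\<dots> = (\<Sum>j\<in>UNIV. \<pi> j * ((e j)^2 * walk_sum Q k j))"
    by (simp add: sum_distrib_right[symmetric] pi_mult_P_sum)
  also have "\<dots> = (diagm e *v root_pi) \<bullet> ((*v) G ^^ k) (diagm e *v root_pi)"
    unfolding iterate by (simp add: inner_vec_def diagm_vector root_pi_def square)
  finally show ?thesis unfolding Q_def G_def .
qed

lemma path_prob_tail_le:
  fixes f :: "'s \<Rightarrow> real"
  assumes "0 \<le> t" and "1 \<le> n"
  defines "e \<equiv> \<lambda>i. exp (t * f i / 2)"
  shows "path_prob P \<pi> n (\<lambda>xs. a \<le> (\<Sum>k=1..n. f (xs!k)))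
    \<le> exp (- (t * a)) * (norm (diagm e *v root_pi))^2
      * largest_eig (diagm e ** sym_P ** diagm e) ^ (n - 1)"
proof -
  define G where "G = diagm e ** sym_P ** diagm e"
  define c where "c = diagm e *v root_pi"
  obtain k where n: "n = Suc k" using \<open>1 \<le> n\<close> by (cases n) auto
  have e_pos: "\<And>i. 0 < e i" by (simp add: e_def)
  have "0 < largest_eig G" unfolding G_def by (intro largest_eig_tilted_sym_P_pos) (simp add: e_def)
  have norm_G: "norm (G *v x) \<le> largest_eig G * norm x" for x
    unfolding G_def using e_pos
    by (intro norm_matrix_vector_le_largest_eig transpose_diagm_congruence[OF transpose_sym_P]
        tilted_sym_P_nonneg less_imp_le)
  have exp_square: "exp (t * f j) = (e j)^2" for j
    by (simp add: e_def power2_eq_square flip: exp_add)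
  have "path_prob P \<pi> n (\<lambda>xs. a \<le> (\<Sum>k=1..n. f (xs!k)))
      \<le> exp (- (t * a)) * (\<Sum>i\<in>UNIV. \<pi> i * walk_sum (\<lambda>i j. P$i$j * exp (t * f j)) n i)"
    by (rule path_prob_le_exp_moment[OF stochastic less_imp_le[OF pi_pos] \<open>0 \<le> t\<close>])
  also have "(\<Sum>i\<in>UNIV. \<pi> i * walk_sum (\<lambda>i j. P$i$j * exp (t * f j)) n i)
      = c \<bullet> ((*v) G ^^ k) c"
    unfolding exp_square n c_def G_def by (rule exp_moment_eq_iterate)
  also have "c \<bullet> ((*v) G ^^ k) c \<le> norm c * (largest_eig G ^ k * norm c)"
    using norm_funpow_matrix_vector_le[OF norm_G less_imp_le[OF \<open>0 < largest_eig G\<close>]]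
    by (intro order_trans[OF norm_cauchy_schwarz] mult_left_mono) simp_all
  finally show ?thesis
    unfolding n c_def G_def by (simp add: power2_eq_square mult_ac)
qed

end

section \<open>The tail bound\<close>

lemma exp_rate_eq:
  assumes "0 < x" and "1 \<le> n"
  shows "exp (- real n * (t * c - ln x)) = exp (- (t * (real n * c))) * x * x ^ (n - 1)"
proof -
  have "exp (- real n * (t * c - ln x)) = exp (- (t * (real n * c))) * exp (real n * ln x)"
    by (simp add: algebra_simps flip: exp_add)
  also have "exp (real n * ln x) = x * x ^ (n - 1)"
    using assms by (simp add: exp_of_nat_mult power_eq_if[of x n])
  finally show ?thesis by (simp add: mult.assoc)
qed

lemma tail_bound_rates:
  fixes p t c C z y :: real
  assumes tail: "p \<le> exp (- (t * (real n * c))) * C * z ^ (n - 1)"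
    and "1 \<le> n" "0 < z" "z \<le> y" "0 \<le> C" "C \<le> y"
  shows "p \<le> C / z * exp (- real n * (t * c - ln z))
    \<and> C / z * exp (- real n * (t * c - ln z)) \<le> C / y * exp (- real n * (t * c - ln y))
    \<and> p \<le> exp (- real n * (t * c - ln y))"
proof -
  define E where "E = exp (- (t * (real n * c)))"
  have "0 < y" using assms by linarith
  have rate_z: "C / z * exp (- real n * (t * c - ln z)) = E * C * z ^ (n - 1)"
    using exp_rate_eq[OF \<open>0 < z\<close> \<open>1 \<le> n\<close>] \<open>0 < z\<close> by (simp add: E_def)
  have rate_y: "C / y * exp (- real n * (t * c - ln y)) = E * C * y ^ (n - 1)"
    using exp_rate_eq[OF \<open>0 < y\<close> \<open>1 \<le> n\<close>] \<open>0 < y\<close> by (simp add: E_def)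
  have "z ^ (n - 1) \<le> y ^ (n - 1)" using assms by (intro power_mono) simp_all
  then have "E * C * z ^ (n - 1) \<le> E * C * y ^ (n - 1)"
    using \<open>0 \<le> C\<close> by (intro mult_left_mono) (simp_all add: E_def)
  moreover have "E * C * y ^ (n - 1) \<le> E * y * y ^ (n - 1)"
    using \<open>C \<le> y\<close> \<open>0 < y\<close> by (intro mult_right_mono mult_left_mono) (simp_all add: E_def)
  ultimately show ?thesis
    using tail exp_rate_eq[OF \<open>0 < y\<close> \<open>1 \<le> n\<close>, where t = t and c = c]
    unfolding rate_z rate_y E_def by linarith
qed

theorem proposition2:
  fixes P :: "real^'s::finite^'s" and \<pi> :: "'s \<Rightarrow> real" and f :: "'s \<Rightarrow> real"
    and \<epsilon> t :: real and n :: nat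
  assumes "stochastic P" and "irreducible_mc P" and "aperiodic_mc P"
    and "stationary_dist P \<pi>" and "reversible_mc P \<pi>"
    and "Min (range f) = 0" and "Max (range f) = 1"
    and "\<epsilon> > 0" and "n \<ge> 1" and "t \<ge> 0"
  defines "lam0 \<equiv> max 0 (second_eig P)"
    and "\<mu> \<equiv> (\<Sum>i\<in>UNIV. \<pi> i * f i)"
    and "D \<equiv> diagm (\<lambda>i. sqrt (\<pi> i))"
    and "Dt \<equiv> diagm (\<lambda>i. exp (t * f i / 2))"
    and "\<gamma>1 \<equiv> (\<chi> i. sqrt (\<pi> i)) :: real^'s"
  defines "pev \<equiv> path_prob P \<pi> n (\<lambda>xs. (\<Sum>k=1..n. f (xs ! k)) \<ge> real n * (\<mu> + \<epsilon>))"
    and "G \<equiv> Dt ** D ** P ** matrix_inv D ** Dt"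
    and "H \<equiv> Dt ** (lam0 *\<^sub>R mat 1 + (1 - lam0) *\<^sub>R (\<chi> i j. \<gamma>1 $ i * \<gamma>1 $ j)) ** Dt"
  defines "\<zeta> \<equiv> largest_eig G" and "\<eta> \<equiv> largest_eig H"
  shows "pev \<le> (norm (Dt *v \<gamma>1))^2 / \<zeta> * exp (- real n * (t * (\<mu> + \<epsilon>) - ln \<zeta>))
    \<and> (norm (Dt *v \<gamma>1))^2 / \<zeta> * exp (- real n * (t * (\<mu> + \<epsilon>) - ln \<zeta>))
        \<le> (norm (Dt *v \<gamma>1))^2 / \<eta> * exp (- real n * (t * (\<mu> + \<epsilon>) - ln \<eta>))
    \<and> pev \<le> exp (- real n * (t * (\<mu> + \<epsilon>) - ln \<eta>))"
proof -
  have "\<And>i. 0 < \<pi> i" using assms(1,2,4) by (rule stationary_dist_pos)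
  then interpret reversible_chain P \<pi>
    using assms(1,4,5) by unfold_locales (simp_all add: stationary_dist_def)
  define e where "e = (\<lambda>i. exp (t * f i / 2))"
  have e: "\<And>i. e i \<noteq> 0" by (simp add: e_def)
  have Dt_e: "Dt = diagm e" and \<gamma>1: "\<gamma>1 = root_pi"
    by (simp_all add: Dt_def e_def \<gamma>1_def root_pi_def)
  have G: "G = diagm e ** sym_P ** diagm e"
    unfolding G_def D_def Dt_e sym_P_eq_conj[symmetric] by (simp add: matrix_mul_assoc)
  have H: "H = diagm e ** (lam0 *\<^sub>R mat 1 + (1 - lam0) *\<^sub>R (\<chi> i j. root_pi$i * root_pi$j)) ** diagm e"
    unfolding H_def Dt_e \<gamma>1 ..
  have tail: "pev \<le> exp (- (t * (real n * (\<mu> + \<epsilon>)))) * (norm (Dt *v \<gamma>1))^2 * \<zeta> ^ (n - 1)"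
    unfolding pev_def \<zeta>_def G Dt_e \<gamma>1 e_def using assms(9,10) by (intro path_prob_tail_le) simp_all
  show ?thesis
  proof (rule tail_bound_rates[OF tail \<open>n \<ge> 1\<close>])
    show "0 < \<zeta>" unfolding \<zeta>_def G by (rule largest_eig_tilted_sym_P_pos[OF e])
    show "\<zeta> \<le> \<eta>" unfolding \<zeta>_def \<eta>_def G H lam0_def by (rule largest_eig_tilted_sym_P_le)
    show "(norm (Dt *v \<gamma>1))^2 \<le> \<eta>" unfolding \<eta>_def H Dt_e \<gamma>1 lam0_def
      by (rule norm_diagm_unit_le_largest_eig[OF norm_root_pi e]) simp
  qed simp
qed

end
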